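(* Let $a>0$, let $\boldsymbol{v}_1,\dots,\boldsymbol{v}_p$ be any orthonormal basis of $\mathbb{R}^p$, and let $\boldsymbol{X}_1,\dots,\boldsymbol{X}_n$ be i.i.d. uniformly distributed on the finite set $\{\sqrt{p}\,\boldsymbol{v}_1,\dots,\sqrt{p}\,\boldsymbol{v}_p\}$. Then the quantity $$\mathcal{R} := \frac{a^2 p}{16\Big(\inf_{\mathbf{R}\in\mathcal{O}}\max_{j\in\{1,\dots,p\}} \mathbb{E}\sum_{i=1}^n |(\boldsymbol{X}_i^\top\mathbf{R})_j|\Big)^2},$$ where $\mathcal{O}$ is the set of all $p\times p$ orthogonal matrices, equals $$\mathcal{R}=\frac{a^2p^2}{16n^2}.$$
   Context: $(\boldsymbol{X}_i^\top\mathbf{R})_j$ is the $j$-th coordinate of the row vector $\boldsymbol{X}_i^\top\mathbf{R}$. The expectation is over $\boldsymbol{X}_1,\dots,\boldsymbol{X}_n$. ($\mathcal{R}$ is the quantity that appears as a minimax lower bound for the squared Euclidean estimation error in the linear model $Y_i=\boldsymbol{X}_i^\top\boldsymbol{\beta}^*+\varepsilon_i$ with noise $\varepsilon_i\sim U([-a,a])$ independent of the design.) *)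

theory Defs
  imports "HOL-Probability.Probability"
begin

definition orthonormal_basis :: "('i::finite \<Rightarrow> 'b::euclidean_space) \<Rightarrow> bool" where
  "orthonormal_basis v \<longleftrightarrow>
     (\<forall>i j. v i \<bullet> v j = (if i = j then 1 else 0)) \<and> span (range v) = UNIV"

text \<open>The law is compared on the Borel sets: \<^term>\<open>uniform_count_measure S\<close> lives on the
  power set of \<^term>\<open>S\<close>, so it is pushed forward along the inclusion of \<^term>\<open>S\<close>.\<close>

definition iid_uniform_on ::
  "'w measure \<Rightarrow> 'i set \<Rightarrow> ('i \<Rightarrow> 'w \<Rightarrow> 'b::topological_space) \<Rightarrow> 'b set \<Rightarrow> bool" where
  "iid_uniform_on M I X S \<longleftrightarrow>
     prob_space.indep_vars M (\<lambda>_. borel) X I \<and>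
     (\<forall>i\<in>I. distr M borel (X i) = distr (uniform_count_measure S) borel (\<lambda>x. x))"

text \<open>Here \<open>X i \<omega> v* R\<close> is the row vector \<open>X\<^sub>i\<^sup>T R\<close>, and the
  dimension \<open>p\<close> is \<open>CARD('p)\<close>.\<close>

definition minimax_bound ::
  "real \<Rightarrow> 'w measure \<Rightarrow> nat \<Rightarrow> (nat \<Rightarrow> 'w \<Rightarrow> real^'p) \<Rightarrow> real" where
  "minimax_bound a M n X =
     a\<^sup>2 * real CARD('p) /
     (16 * (INF R \<in> {R :: real^'p^'p. orthogonal_matrix R}.
              MAX j \<in> (UNIV :: 'p set).
                (\<integral>\<omega>. (\<Sum>i=1..n. \<bar>(X i \<omega> v* R) $ j\<bar>) \<partial>M))\<^sup>2)"

end

theory Submission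
  imports Defs
begin

text \<open>Writing \<open>V\<close> for the orthogonal matrix with rows \<open>v\<^sub>k\<close> and \<open>u\<close> for the \<open>j\<close>-th column of \<open>R\<close>,
  the expectation is \<open>n / sqrt p\<close> times the \<open>\<ell>\<^sup>1\<close>-norm of \<open>V u\<close>. As \<open>V u\<close> is a unit vector, this is at
  least \<open>n / sqrt p\<close>, with equality for every \<open>j\<close> when \<open>R\<close> is the transpose of \<open>V\<close>.\<close>

text \<open>Only the law of a single \<open>X i\<close> enters. Both sides of the law equation are
  push-forwards, so changing variables twice carries the integral over to
  \<open>uniform_count_measure S\<close>, where finiteness of \<open>S\<close> makes every real
  function integrable.\<close>

lemma iid_uniform_on_expectation:
  fixes X :: "'i \<Rightarrow> 'w \<Rightarrow> 'b::t2_space" and f :: "'b \<Rightarrow> real"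
  assumes "prob_space M" and "iid_uniform_on M I X S" and "i \<in> I" and "finite S"
    and "f \<in> borel_measurable borel"
  shows "integrable M (\<lambda>\<omega>. f (X i \<omega>))"
    and "(\<integral>\<omega>. f (X i \<omega>) \<partial>M) = (\<Sum>x\<in>S. f x) / card S"
proof -
  interpret prob_space M by fact
  have X: "X i \<in> borel_measurable M"
    using assms(2,3) by (auto simp: iid_uniform_on_def indep_vars_def)
  have D: "distr M borel (X i) = distr (uniform_count_measure S) borel (\<lambda>x. x)"
    using assms(2,3) by (simp add: iid_uniform_on_def)
  have U: "(\<lambda>x. x) \<in> uniform_count_measure S \<rightarrow>\<^sub>M borel"
    by (simp add: uniform_count_measure_def)
  have "integrable (uniform_count_measure S) f"
    by (simp add: uniform_count_measure_def integrable_point_measure_finite assms(4))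
  then have "integrable (distr M borel (X i)) f"
    unfolding D by (simp add: integrable_distr_eq[OF U assms(5)])
  then show "integrable M (\<lambda>\<omega>. f (X i \<omega>))"
    by (simp add: integrable_distr_eq[OF X assms(5)])
  have "(\<integral>\<omega>. f (X i \<omega>) \<partial>M) = integral\<^sup>L (distr M borel (X i)) f"
    by (simp add: integral_distr[OF X assms(5)])
  also have "\<dots> = integral\<^sup>L (uniform_count_measure S) f"
    unfolding D by (simp add: integral_distr[OF U assms(5)])
  also have "\<dots> = (\<Sum>x\<in>S. f x) / card S"
    by (simp add: integral_uniform_count_measure assms(4))
  finally show "(\<integral>\<omega>. f (X i \<omega>) \<partial>M) = (\<Sum>x\<in>S. f x) / card S" .
qed

lemma orthogonal_matrix_orthonormal_basis:
  fixes v :: "'p::finite \<Rightarrow> real^'p"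
  assumes "orthonormal_basis v"
  shows "orthogonal_matrix (\<chi> k. v k)"
proof -
  have "row k (\<chi> k. v k) = v k" for k
    by (simp add: row_def vec_eq_iff)
  then show ?thesis
    using assms unfolding orthogonal_matrix_orthonormal_rows
    by (auto simp: orthonormal_basis_def orthogonal_def norm_eq_1)
qed

lemma vector_matrix_mult_component: "(x v* A) $ j = x \<bullet> column j A" for A :: "real^'m^'n"
  by (simp add: vector_matrix_mult_def column_def inner_vec_def mult.commute)

text \<open>\<open>V\<close> preserves the Euclidean norm, and the l1-norm dominates it.\<close>

lemma orthogonal_matrix_l1_ge_norm:
  fixes V :: "real^'p^'p"
  assumes "orthogonal_matrix V"
  shows "norm u \<le> (\<Sum>k\<in>UNIV. \<bar>(V *v u) $ k\<bar>)"
proof -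
  have "orthogonal_transformation ((*v) V)"
    using assms by (simp add: orthogonal_transformation_matrix)
  then have "norm u = norm (V *v u)"
    by (simp add: orthogonal_transformation)
  then show ?thesis
    using norm_le_l1_cart[of "V *v u"] by simp
qed

text \<open>By linearity each of the \<open>n\<close> terms contributes the same mean over the
  design points. Averaging gives the factor 1/p and the scaling of the points gives sqrt p, whence 1
  / sqrt p.\<close>

lemma expected_l1_design:
  fixes v :: "'p::finite \<Rightarrow> real^'p" and X :: "nat \<Rightarrow> 'w \<Rightarrow> real^'p" and R :: "real^'p^'p"
  assumes v: "orthonormal_basis v" and M: "prob_space M"
    and X: "iid_uniform_on M {1..n} X (range (\<lambda>k. sqrt (real CARD('p)) *\<^sub>R v k))"
  shows "(\<integral>\<omega>. (\<Sum>i=1..n. \<bar>(X i \<omega> v* R) $ j\<bar>) \<partial>M)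
    = real n / sqrt (real CARD('p)) * (\<Sum>k\<in>UNIV. \<bar>v k \<bullet> column j R\<bar>)"
proof -
  define p where "p = real CARD('p)"
  define w where "w k = sqrt p *\<^sub>R v k" for k
  define f where "f x = \<bar>x \<bullet> column j R\<bar>" for x :: "real^'p"
  have p: "p > 0" by (simp add: p_def)
  \<comment> \<open>Injectivity makes the support have exactly p points and lets sums over it be
    indexed by \<open>k\<close>. If \<open>v k = v l\<close> with distinct indices, orthonormality
    would give 1 = 0.\<close>
  have w: "inj w"
  proof (rule injI)
    fix k l assume "w k = w l"
    then have "v k = v l" using p by (simp add: w_def)
    then show "k = l" using v unfolding orthonormal_basis_def by (metis zero_neq_one)
  qed
  have f: "f \<in> borel_measurable borel" unfolding f_def by measurable
  have X': "iid_uniform_on M {1..n} X (range w)"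
    using X by (simp add: w_def[abs_def] p_def)
  note E = iid_uniform_on_expectation[OF M X' _ _ f]
  have "(\<integral>\<omega>. f (X i \<omega>) \<partial>M) = (\<Sum>k\<in>UNIV. \<bar>v k \<bullet> column j R\<bar>) / sqrt p" if "i \<in> {1..n}" for i
  proof -
    have "(\<integral>\<omega>. f (X i \<omega>) \<partial>M) = (\<Sum>x\<in>range w. f x) / p"
      using E(2)[OF that] w by (simp add: card_image p_def)
    also have "(\<Sum>x\<in>range w. f x) = sqrt p * (\<Sum>k\<in>UNIV. \<bar>v k \<bullet> column j R\<bar>)"
      unfolding sum.reindex[OF w] using p by (simp add: f_def w_def abs_mult sum_distrib_left)
    also have "sqrt p * (\<Sum>k\<in>UNIV. \<bar>v k \<bullet> column j R\<bar>) / p = (\<Sum>k\<in>UNIV. \<bar>v k \<bullet> column j R\<bar>) / sqrt p"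
      using sqrt_divide_self_eq[of p] p
      by (metis divide_inverse less_imp_le mult.commute times_divide_eq_left)
    finally show ?thesis .
  qed
  moreover have "(\<integral>\<omega>. (\<Sum>i=1..n. f (X i \<omega>)) \<partial>M) = (\<Sum>i=1..n. (\<integral>\<omega>. f (X i \<omega>) \<partial>M))"
    using E(1) by (intro Bochner_Integration.integral_sum) auto
  ultimately show ?thesis
    by (simp add: f_def vector_matrix_mult_component p_def)
qed

theorem corollary2p20:
  fixes a :: real and n :: nat
    and v :: "'p::finite \<Rightarrow> real^'p"
    and M :: "'w measure"
    and X :: "nat \<Rightarrow> 'w \<Rightarrow> real^'p"
  assumes "a > 0" and "n \<ge> 1"
    and "orthonormal_basis v"
    and "prob_space M"
    and "iid_uniform_on M {1..n} X (range (\<lambda>k. sqrt (real CARD('p)) *\<^sub>R v k))"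
  shows "minimax_bound a M n X = a\<^sup>2 * (real CARD('p))\<^sup>2 / (16 * (real n)\<^sup>2)"
proof -
  define V where "V = (\<chi> k. v k)"
  define c where "c = real n / sqrt (real CARD('p))"
  define L where "L R j = (\<Sum>k\<in>UNIV. \<bar>v k \<bullet> column j R\<bar>)" for R :: "real^'p^'p" and j
  have V: "orthogonal_matrix V"
    unfolding V_def by (rule orthogonal_matrix_orthonormal_basis) fact
  have E: "(\<integral>\<omega>. (\<Sum>i=1..n. \<bar>(X i \<omega> v* R) $ j\<bar>) \<partial>M) = c * L R j" for R j
    unfolding c_def L_def by (rule expected_l1_design) fact+
  \<comment> \<open>\<open>L R j\<close> is the l1-norm of \<open>V *v u\<close> for the unit vector
    \<open>u = column j R\<close>.\<close>
  have lower: "1 \<le> L R j" if "orthogonal_matrix R" for R j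
  proof -
    have "norm (column j R) = 1"
      using that by (simp add: orthogonal_matrix_orthonormal_columns)
    moreover have "(V *v u) $ k = v k \<bullet> u" for k u
      by (simp add: V_def matrix_vector_mul_component)
    ultimately show ?thesis
      using orthogonal_matrix_l1_ge_norm[OF V, of "column j R"] by (simp add: L_def)
  qed
  \<comment> \<open>Column \<open>j\<close> of \<open>transpose V\<close> is \<open>v j\<close>,
    whose coordinates in the basis form a standard unit vector; there the l1-norm and the Euclidean
    norm agree.\<close>
  have attained: "L (transpose V) j = 1" for j
  proof -
    have "v k \<bullet> column j (transpose V) = (if k = j then 1 else 0)" for k
      using assms(3) by (simp add: V_def row_def orthonormal_basis_def)
    then have "L (transpose V) j = (\<Sum>k\<in>UNIV. if k = j then 1 else 0)"
      unfolding L_def by (intro sum.cong) auto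
    then show ?thesis by simp
  qed
  \<comment> \<open>The infimum is a minimum: \<open>c\<close> is the value at
    \<open>transpose V\<close> and a lower bound for all values.\<close>
  have "(INF R \<in> {R. orthogonal_matrix R}. MAX j \<in> UNIV. c * L R j) = c"
  proof (rule cInf_eq_minimum)
    have "(MAX j \<in> UNIV. c * L (transpose V) j) = c"
      by (simp add: attained)
    then show "c \<in> (\<lambda>R. MAX j \<in> UNIV. c * L R j) ` {R. orthogonal_matrix R}"
      using V by (intro image_eqI[where x = "transpose V"]) auto
  next
    fix y assume "y \<in> (\<lambda>R. MAX j \<in> UNIV. c * L R j) ` {R. orthogonal_matrix R}"
    then obtain R where R: "orthogonal_matrix R" and y: "y = (MAX j \<in> UNIV. c * L R j)" by blast
    have "c \<le> c * L R j" for j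
      using mult_left_mono[OF lower[OF R], of c] by (simp add: c_def)
    \<comment> \<open>A single index \<open>j\<close> already bounds the maximum from below.\<close>
    then show "c \<le> y" unfolding y by (subst Max_ge_iff) auto
  qed
  then have "minimax_bound a M n X = a\<^sup>2 * real CARD('p) / (16 * c\<^sup>2)"
    unfolding minimax_bound_def E by simp
  then show ?thesis
    \<comment> \<open>Since \<open>c\<^sup>2\<close> is n^2 / p, dividing by it supplies the second
      factor p.\<close>
    by (simp add: c_def power_divide power2_eq_square)
qed

end
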